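(* Let $j\in\mathbb{N}$, $j\ge 1$, and let $x\in\mathbb{R}^n$ be the coefficient vector of a function $u_h\in V_h$, i.e. $u_h=\sum_{i=1}^n x_i\varphi^h_{z_i}$. Let $w_h\in V_h$ be the function with coefficient vector $\mathcal{P}_j(x)$, where $\mathcal{P}_j$ denotes $j$ steps of the conjugate gradient method for $A_h$ preconditioned by one multigrid V-cycle on the levels from $\varepsilon$ to $h$. Then the support of $w_h$ is at most $3j$ layers of $\varepsilon$-cubes larger than the support of $u_h$, i.e. $$\operatorname{supp}(w_h)\subseteq\{y\in\overline{D} : \operatorname{dist}_\infty(y,\operatorname{supp}(u_h))\le 3j\,\varepsilon\},$$ where $\operatorname{dist}_\infty$ is the distance in the maximum norm of $\mathbb{R}^d$ (if $u_h=0$, then $w_h=0$).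
   Context: **Meshes and spaces.** $D\subseteq\mathbb{R}^d$ is a bounded domain whose closure is the union of the cubes of a uniform Cartesian mesh $\mathcal{T}^\varepsilon$ of (closed, axis-parallel) cubes of side length $\varepsilon=2^{-\ell_\varepsilon}$. The potential $V\in L^\infty(D)$ is non-negative and constant on each cube of $\mathcal{T}^\varepsilon$. For each integer $\ell$ with $\ell_\varepsilon\le\ell\le\ell_h$, $\mathcal{T}_\ell$ denotes the uniform refinement of $\mathcal{T}^\varepsilon$ into cubes of side length $h_\ell=2^{-\ell}$. Thus $\mathcal{T}_{\ell_\varepsilon}=\mathcal{T}^\varepsilon$, and the finest mesh is $\mathcal{T}^h=\mathcal{T}_{\ell_h}$ with $h=2^{-\ell_h}\le\varepsilon$. $V_\ell\subseteq H^1_0(D)$ is the conforming $Q_1$ finite element space on $\mathcal{T}_\ell$: continuous functions, vanishing on $\partial D$, that are polynomials of partial degree at most one on each cube. Its basis consists of the $Q_1$ hat functions associated with the interior nodes of $\mathcal{T}_\ell$ (value $1$ at that node and $0$ at all other nodes). Write $V_h=V_{\ell_h}$, $n=\dim V_h$, and $\varphi^h_{z_1},\dots,\varphi^h_{z_n}$ for its hat functions. **Matrices.** Let $a(u,v)=\int_D\nabla u\cdot\nabla v+V\,u\,v\,dx$. $A_\ell$ is the stiffness matrix of $a$ with respect to the hat basis of $V_\ell$, with diagonal part $\Delta_\ell=\operatorname{diag}(A_\ell)$. Write $A_h=A_{\ell_h}$. For $\ell>\ell_\varepsilon$, $P_\ell$ is the prolongation matrix representing the inclusion $V_{\ell-1}\subseteq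 V_\ell$ in the hat bases, and $P_\ell^T$ is the restriction. **Multigrid V-cycle.** The V-cycle starts from the zero vector and uses a single Jacobi relaxation step per level and no direct solve. On the coarsest level, $B_{\ell_\varepsilon}(b)=\Delta_{\ell_\varepsilon}^{-1}b$. For $\ell>\ell_\varepsilon$, $B_\ell(b)$ is obtained with one relaxation step on level $\ell$, placed either - before the coarse-grid correction: $y=\Delta_\ell^{-1}b$, $B_\ell(b)=y+P_\ell B_{\ell-1}(P_\ell^T(b-A_\ell y))$; or - after it: $y=P_\ell B_{\ell-1}(P_\ell^T b)$, $B_\ell(b)=y+\Delta_\ell^{-1}(b-A_\ell y)$. The claim is for either placement (the same on all levels). Set $B=B_{\ell_h}$. **The map $\mathcal{P}_j$.** For $b\in\mathbb{R}^n$, $\mathcal{P}_j(b)$ is the iterate $x_j$ after $j$ steps of the preconditioned conjugate gradient method for $A_hx=b$ with zero initial guess: $x_0=0$, $r_0=b$, $p_0=s_0=B(r_0)$, and for $k=0,1,\dots$ $$\alpha_k=\frac{r_k^Ts_k}{p_k^TA_hp_k},\quad x_{k+1}=x_k+\alpha_kp_k,\quad r_{k+1}=r_k-\alpha_kA_hp_k,\quad s_{k+1}=B(r_{k+1}),\quad \beta_k=\frac{r_{k+1}^Ts_{k+1}}{r_k^Ts_k},\quad p_{k+1}=s_{k+1}+\beta_kp_k.$$ If a denominator vanishes, the iteration stops and the current iterate is returned. In the claim the right-hand side is $b=x$. *)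

theory Defs
  imports "HOL-Analysis.Analysis"
begin

section \<open>The domain, the mesh and the potential\<close>

text \<open>
  \<open>Dom\<close> is the domain \<open>D\<close>, \<open>coarse\<close> the mesh \<open>T\<^sup>\<epsilon>\<close>, \<open>lev_eps\<close> and \<open>lev_h\<close> the levels
  of the coarsest and of the finest mesh, \<open>pot\<close> the potential \<open>V\<close>.  The grid containing
  the mesh may be translated; \<open>orig\<close> is one of its grid points.
\<close>
record ('d::finite) mesh_problem =
  Dom :: "(real^'d) set"
  orig :: "real^'d"
  coarse :: "(real^'d) set set"
  lev_eps :: int
  lev_h :: int
  pot :: "real^'d \<Rightarrow> real"

definition mesh_size :: "int \<Rightarrow> real" where
  "mesh_size l = 2 powi (- l)"

definition grid_point :: "('d::finite) mesh_problem \<Rightarrow> int \<Rightarrow> int^'d \<Rightarrow> real^'d" where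
  "grid_point S l k = orig S + mesh_size l *\<^sub>R (\<chi> i. of_int (k $ i))"

definition grid_cube :: "('d::finite) mesh_problem \<Rightarrow> int \<Rightarrow> int^'d \<Rightarrow> (real^'d) set" where
  "grid_cube S l k = cbox (grid_point S l k) (grid_point S l (k + 1))"

text \<open>
  \<open>V\<close> is an \<open>L\<^sup>\<infinity>\<close> function, so all conditions on it hold almost everywhere; a function that
  is pointwise constant on each closed cube would be constant on all of \<open>D\<close>.
\<close>
definition valid_problem :: "('d::finite) mesh_problem \<Rightarrow> bool" where
  "valid_problem S \<longleftrightarrow>
     open (Dom S) \<and> connected (Dom S) \<and> Dom S \<noteq> {} \<and> bounded (Dom S) \<and>
     coarse S \<subseteq> range (grid_cube S (lev_eps S)) \<and>
     closure (Dom S) = \<Union> (coarse S) \<and>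
     lev_eps S \<le> lev_h S \<and>
     pot S \<in> borel_measurable (lebesgue_on (Dom S)) \<and>
     (\<exists>M. AE y in lebesgue_on (Dom S). \<bar>pot S y\<bar> \<le> M) \<and>
     (AE y in lebesgue_on (Dom S). 0 \<le> pot S y) \<and>
     (\<forall>K\<in>coarse S. \<exists>c. AE y in lebesgue_on (K \<inter> Dom S). pot S y = c)"

definition mesh :: "('d::finite) mesh_problem \<Rightarrow> int \<Rightarrow> (real^'d) set set" where
  "mesh S l = {Q \<in> range (grid_cube S l). \<exists>K\<in>coarse S. Q \<subseteq> K}"

definition nodes :: "('d::finite) mesh_problem \<Rightarrow> int \<Rightarrow> (real^'d) set" where
  "nodes S l = range (grid_point S l) \<inter> \<Union> (mesh S l)"

text \<open>
  The second condition says that the hat function of \<open>z\<close> vanishes on \<open>\<partial>D\<close>.  It follows from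
  \<open>z \<in> D\<close> when \<open>D\<close> is the interior of its closure (see the lemma below).  It
  is relevant only if \<open>D\<close> has a slit that is not resolved by the mesh: a node next to such a
  slit has no hat function in the finite element space.
\<close>
definition interior_nodes :: "('d::finite) mesh_problem \<Rightarrow> int \<Rightarrow> (real^'d) set" where
  "interior_nodes S l =
     {z \<in> nodes S l. z \<in> Dom S \<and> interior (\<Union> {Q \<in> mesh S l. z \<in> Q}) \<subseteq> Dom S}"

lemma interior_nodes_eq:
  assumes "valid_problem S" and "interior (closure (Dom S)) = Dom S"
  shows "interior_nodes S l = nodes S l \<inter> Dom S"
proof -
  have "interior (\<Union> {Q \<in> mesh S l. z \<in> Q}) \<subseteq> Dom S" for z
  proof -
    have "\<Union> {Q \<in> mesh S l. z \<in> Q} \<subseteq> closure (Dom S)"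
      using assms(1) by (fastforce simp: mesh_def valid_problem_def)
    then show ?thesis
      using assms(2) interior_mono by blast
  qed
  then show ?thesis
    by (auto simp: interior_nodes_def)
qed

section \<open>The \<open>Q\<^sub>1\<close> finite element spaces\<close>

text \<open>Polynomials of degree at most one in each variable are the linear combinations of the
  square-free monomials.\<close>
definition Q1_on :: "(real^'d) set \<Rightarrow> (real^'d \<Rightarrow> real) \<Rightarrow> bool" where
  "Q1_on Q v \<longleftrightarrow>
     (\<exists>c :: 'd set \<Rightarrow> real. \<forall>y\<in>Q. v y = (\<Sum>I\<in>UNIV. c I * (\<Prod>i\<in>I. y $ i)))"

text \<open>Functions on the closure of \<open>D\<close> are extended by zero.\<close>
definition fe_space :: "('d::finite) mesh_problem \<Rightarrow> int \<Rightarrow> (real^'d \<Rightarrow> real) set" where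
  "fe_space S l =
     {v. continuous_on (closure (Dom S)) v \<and>
         (\<forall>y\<in>frontier (Dom S). v y = 0) \<and>
         (\<forall>Q\<in>mesh S l. Q1_on Q v) \<and>
         (\<forall>y. y \<notin> closure (Dom S) \<longrightarrow> v y = 0)}"

definition hat :: "('d::finite) mesh_problem \<Rightarrow> int \<Rightarrow> real^'d \<Rightarrow> real^'d \<Rightarrow> real" where
  "hat S l z = (THE v. v \<in> fe_space S l \<and> v z = 1 \<and> (\<forall>z'\<in>nodes S l - {z}. v z' = 0))"

text \<open>
  Coefficient vectors are indexed by the interior nodes themselves: a vector of level \<open>l\<close> is
  a function of which only the values on \<open>interior_nodes S l\<close> are used, and likewise for
  matrices.
\<close>
definition fe_fun :: "('d::finite) mesh_problem \<Rightarrow> int \<Rightarrow> (real^'d \<Rightarrow> real) \<Rightarrow> real^'d \<Rightarrow> real" where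
  "fe_fun S l x = (\<lambda>y. \<Sum>z\<in>interior_nodes S l. x z * hat S l z y)"

definition coeffs :: "('d::finite) mesh_problem \<Rightarrow> int \<Rightarrow> (real^'d \<Rightarrow> real) \<Rightarrow> real^'d \<Rightarrow> real" where
  "coeffs S l v = (THE c. fe_fun S l c = v \<and> (\<forall>z. z \<notin> interior_nodes S l \<longrightarrow> c z = 0))"

section \<open>Matrices\<close>

definition mat_vec :: "'a set \<Rightarrow> ('b \<Rightarrow> 'a \<Rightarrow> real) \<Rightarrow> ('a \<Rightarrow> real) \<Rightarrow> 'b \<Rightarrow> real" where
  "mat_vec I M x = (\<lambda>i. \<Sum>j\<in>I. M i j * x j)"

definition dot :: "'a set \<Rightarrow> ('a \<Rightarrow> real) \<Rightarrow> ('a \<Rightarrow> real) \<Rightarrow> real" where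
  "dot I x y = (\<Sum>i\<in>I. x i * y i)"

text \<open>
  Finite element functions are differentiable off the null set of faces of the mesh, and their
  weak gradient is the classical one there; the value on the faces is immaterial.
\<close>
definition grad :: "(real^'d \<Rightarrow> real) \<Rightarrow> real^'d \<Rightarrow> real^'d" where
  "grad v y = (\<chi> i. frechet_derivative v (at y) (axis i 1))"

definition energy :: "('d::finite) mesh_problem \<Rightarrow> (real^'d \<Rightarrow> real) \<Rightarrow> (real^'d \<Rightarrow> real) \<Rightarrow> real" where
  "energy S u v = (LINT y:Dom S|lebesgue. grad u y \<bullet> grad v y + pot S y * u y * v y)"

definition stiffness :: "('d::finite) mesh_problem \<Rightarrow> int \<Rightarrow> real^'d \<Rightarrow> real^'d \<Rightarrow> real" where
  "stiffness S l z z' = energy S (hat S l z') (hat S l z)"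

definition prolongation :: "('d::finite) mesh_problem \<Rightarrow> int \<Rightarrow> real^'d \<Rightarrow> real^'d \<Rightarrow> real" where
  "prolongation S l z z' = coeffs S l (hat S (l - 1) z') z"

section \<open>The multigrid V-cycle\<close>

definition stiff_mult :: "('d::finite) mesh_problem \<Rightarrow> int \<Rightarrow> (real^'d \<Rightarrow> real) \<Rightarrow> real^'d \<Rightarrow> real" where
  "stiff_mult S l = mat_vec (interior_nodes S l) (stiffness S l)"

definition prolong :: "('d::finite) mesh_problem \<Rightarrow> int \<Rightarrow> (real^'d \<Rightarrow> real) \<Rightarrow> real^'d \<Rightarrow> real" where
  "prolong S l = mat_vec (interior_nodes S (l - 1)) (prolongation S l)"

definition restrict :: "('d::finite) mesh_problem \<Rightarrow> int \<Rightarrow> (real^'d \<Rightarrow> real) \<Rightarrow> real^'d \<Rightarrow> real" where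
  "restrict S l = mat_vec (interior_nodes S l) (\<lambda>z' z. prolongation S l z z')"

definition jacobi :: "('d::finite) mesh_problem \<Rightarrow> int \<Rightarrow> (real^'d \<Rightarrow> real) \<Rightarrow> real^'d \<Rightarrow> real" where
  "jacobi S l b = (\<lambda>z. b z / stiffness S l z z)"

datatype smoothing = Pre_Smoothing | Post_Smoothing

function vcycle ::
  "('d::finite) mesh_problem \<Rightarrow> smoothing \<Rightarrow> int \<Rightarrow> (real^'d \<Rightarrow> real) \<Rightarrow> real^'d \<Rightarrow> real" where
  "vcycle S m l b =
     (if l \<le> lev_eps S then jacobi S l b
      else case m of
        Pre_Smoothing \<Rightarrow>
          (let y = jacobi S l b;
               c = prolong S l
                     (vcycle S m (l - 1) (restrict S l (\<lambda>z. b z - stiff_mult S l y z)))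
           in (\<lambda>z. y z + c z))
      | Post_Smoothing \<Rightarrow>
          (let y = prolong S l (vcycle S m (l - 1) (restrict S l b));
               c = jacobi S l (\<lambda>z. b z - stiff_mult S l y z)
           in (\<lambda>z. y z + c z)))"
  by pat_completeness auto
termination
  by (relation "Wellfounded.measure (\<lambda>(S, m, l, b). nat (l - lev_eps S))") auto

section \<open>The preconditioned conjugate gradient method\<close>

text \<open>
  The state is \<open>(x\<^sub>k, r\<^sub>k, s\<^sub>k, p\<^sub>k)\<close>.  Stopping is expressed by leaving the state
  unchanged from then on.  If \<open>r\<^sub>k\<^sup>T s\<^sub>k\<close>, the denominator of \<open>\<beta>\<^sub>k\<close>, vanishes, then \<open>\<alpha>\<^sub>k = 0\<close>
  and \<open>x\<^sub>k\<^sub>+\<^sub>1 = x\<^sub>k\<close>, so that it does not matter which of the two is returned.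
\<close>
type_synonym 'a pcg_state = "('a \<Rightarrow> real) \<times> ('a \<Rightarrow> real) \<times> ('a \<Rightarrow> real) \<times> ('a \<Rightarrow> real)"

definition pcg_step ::
  "'a set \<Rightarrow> ('a \<Rightarrow> 'a \<Rightarrow> real) \<Rightarrow> (('a \<Rightarrow> real) \<Rightarrow> 'a \<Rightarrow> real) \<Rightarrow> 'a pcg_state \<Rightarrow> 'a pcg_state" where
  "pcg_step I A B = (\<lambda>(x, r, s, p).
     (let Ap = mat_vec I A p in
      if dot I p Ap = 0 \<or> dot I r s = 0 then (x, r, s, p)
      else
        (let \<alpha> = dot I r s / dot I p Ap;
             x' = (\<lambda>i. x i + \<alpha> * p i);
             r' = (\<lambda>i. r i - \<alpha> * Ap i);
             s' = B r';
             \<beta> = dot I r' s' / dot I r s;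
             p' = (\<lambda>i. s' i + \<beta> * p i)
         in (x', r', s', p'))))"

definition pcg ::
  "'a set \<Rightarrow> ('a \<Rightarrow> 'a \<Rightarrow> real) \<Rightarrow> (('a \<Rightarrow> real) \<Rightarrow> 'a \<Rightarrow> real) \<Rightarrow> nat \<Rightarrow> ('a \<Rightarrow> real) \<Rightarrow> 'a \<Rightarrow> real" where
  "pcg I A B j b = fst ((pcg_step I A B ^^ j) ((\<lambda>_. 0), b, B b, B b))"

definition mg_pcg ::
  "('d::finite) mesh_problem \<Rightarrow> smoothing \<Rightarrow> nat \<Rightarrow> (real^'d \<Rightarrow> real) \<Rightarrow> real^'d \<Rightarrow> real" where
  "mg_pcg S m =
     pcg (interior_nodes S (lev_h S)) (stiffness S (lev_h S)) (vcycle S m (lev_h S))"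

section \<open>Supports and distances\<close>

definition supp :: "('a::topological_space \<Rightarrow> real) \<Rightarrow> 'a set" where
  "supp f = closure {y. f y \<noteq> 0}"

definition dist_inf :: "real^'d \<Rightarrow> (real^'d) set \<Rightarrow> real" where
  "dist_inf y A = (INF z\<in>A. infnorm (y - z))"

end

theory Submission
  imports Defs
begin

text \<open>
  The stiffness matrix couples only neighbouring nodes, and a prolongation or restriction between
  the levels \<open>l - 1\<close> and \<open>l\<close> couples a coarse node only to the fine nodes inside its patch.  Measured in
  the maximum norm, each of the maps \<open>A\<^sub>l\<close>, \<open>P\<^sub>l\<close> and \<open>P\<^sub>l\<^sup>T\<close> therefore widens the support
  of a coefficient vector by at most \<open>h\<^sub>l\<close>: for \<open>A\<^sub>l\<close> the hats of nodes at distance at least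
  \<open>2 h\<^sub>l\<close> have disjoint open patches (\<open>stiffness_local\<close>), for \<open>P\<^sub>l\<close> a fine node strictly inside a
  patch of radius \<open>2 h\<^sub>l\<close> is at distance at most \<open>h\<^sub>l\<close> from its centre (\<open>prolongation_local\<close>).
  Jacobi relaxation is diagonal and keeps supports.

  A V-cycle uses each of the three maps once on every level above the coarsest, whatever the
  placement of the relaxation step, so it widens supports by
  \<open>\<Sum>\<^sub>l 3 h\<^sub>l = 3 (\<epsilon> - h)\<close> (\<open>supported_near_vcycle\<close>).  The iterate \<open>x\<^sub>j\<close> of
  preconditioned CG involves \<open>j\<close> V-cycles and \<open>j - 1\<close> applications of \<open>A\<^sub>h\<close>
  (\<open>supported_near_pcg\<close>); passing from coefficients to the function adds the width \<open>h\<close> of one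
  hat.  The total is \<open>3 j (\<epsilon> - h) + j h \<le> 3 j \<epsilon>\<close>.  The support is measured from the nodes at which
  \<open>x\<close> does not vanish; these lie in the support of \<open>u\<close>, since \<open>x\<close> contains the nodal values
  of \<open>u\<close> (\<open>fe_fun_at_interior_node\<close>).

  The hat functions and the prolongation are given by unique descriptions.  They are
  identified with explicit tensor products of one-dimensional hats (\<open>hat_eq_tent\<close>,
  \<open>prolongation_eq_tent\<close>).  Existence rests on the fact that the patch of an interior node is a
  full cube inside \<open>D\<close>, uniqueness on the fact that a multilinear function on a cube is determined by its
  values at the vertices.
\<close>

section \<open>Uniform dyadic grids\<close>

lemma infnorm_le_iff_cart:
  fixes x :: "real^'n"
  shows "infnorm x \<le> r \<longleftrightarrow> (\<forall>i. \<bar>x $ i\<bar> \<le> r)"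
proof
  assume "infnorm x \<le> r"
  then show "\<forall>i. \<bar>x $ i\<bar> \<le> r"
    using component_le_infnorm_cart order_trans by blast
next
  assume "\<forall>i. \<bar>x $ i\<bar> \<le> r"
  then show "infnorm x \<le> r"
    unfolding infnorm_cart by (intro cSup_least) auto
qed

lemma infnorm_less_iff_cart:
  fixes x :: "real^'n"
  shows "infnorm x < r \<longleftrightarrow> (\<forall>i. \<bar>x $ i\<bar> < r)"
proof
  assume "infnorm x < r"
  then show "\<forall>i. \<bar>x $ i\<bar> < r"
    using component_le_infnorm_cart order.strict_trans1 by blast
next
  assume *: "\<forall>i. \<bar>x $ i\<bar> < r"
  have "infnorm x = Max (range (\<lambda>i. \<bar>x $ i\<bar>))"
    unfolding infnorm_cart by (subst cSup_eq_Max[symmetric]) (auto intro: arg_cong[where f = Sup])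
  then have "infnorm x \<in> range (\<lambda>i. \<bar>x $ i\<bar>)"
    using Max_in[of "range (\<lambda>i. \<bar>x $ i\<bar>)"] by simp
  then show "infnorm x < r"
    using * by auto
qed

lemma mesh_size_pos: "0 < mesh_size l"
  by (simp add: mesh_size_def)

lemma mesh_size_multiple:
  assumes "l' \<le> l"
  obtains n :: int where "0 < n" "mesh_size l' = of_int n * mesh_size l"
proof
  show "(0::int) < 2 ^ nat (l - l')"
    by simp
  have "(2::real) powi (- l') = 2 powi (l - l') * 2 powi (- l)"
    by (subst power_int_add [symmetric]) auto
  also have "(2::real) powi (l - l') = 2 ^ nat (l - l')"
    using assms by (simp add: power_int_def)
  finally show "mesh_size l' = of_int (2 ^ nat (l - l')) * mesh_size l"
    by (simp add: mesh_size_def)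
qed

lemma mesh_size_pred: "mesh_size (l - 1) = 2 * mesh_size l"
proof -
  have "- (l - 1) = 1 + - l"
    by simp
  then have "(2::real) powi (- (l - 1)) = 2 powi 1 * 2 powi (- l)"
    by (simp only:) (subst power_int_add, auto)
  then show ?thesis
    by (simp add: mesh_size_def)
qed

lemma mesh_size_antimono:
  assumes "l' \<le> l"
  shows "mesh_size l \<le> mesh_size l'"
  using assms by (simp add: mesh_size_def power_int_increasing)

lemma grid_point_nth: "grid_point S l k $ i = orig S $ i + mesh_size l * of_int (k $ i)"
  by (simp add: grid_point_def)

lemma mem_grid_cube:
  "y \<in> grid_cube S l k \<longleftrightarrow>
     (\<forall>i. orig S $ i + mesh_size l * of_int (k $ i) \<le> y $ i \<and>
          y $ i \<le> orig S $ i + mesh_size l * of_int (k $ i + 1))"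
  by (simp add: grid_cube_def mem_box_cart grid_point_nth)

lemma mem_interior_grid_cube:
  "y \<in> interior (grid_cube S l k) \<longleftrightarrow>
     (\<forall>i. orig S $ i + mesh_size l * of_int (k $ i) < y $ i \<and>
          y $ i < orig S $ i + mesh_size l * of_int (k $ i + 1))"
  by (simp add: grid_cube_def mem_box_cart grid_point_nth)

lemma closure_interior_grid_cube: "closure (interior (grid_cube S l k)) = grid_cube S l k"
proof -
  have "box (grid_point S l k) (grid_point S l (k + 1)) \<noteq> {}"
    by (simp add: interval_ne_empty_cart grid_point_nth mesh_size_pos)
  then show ?thesis
    by (simp add: grid_cube_def)
qed

lemma grid_point_refine:
  assumes "l' \<le> l"
  obtains k where "grid_point S l' k' = grid_point S l k"
proof -
  obtain n :: int where n: "mesh_size l' = of_int n * mesh_size l"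
    using mesh_size_multiple assms by metis
  have "grid_point S l' k' = grid_point S l (\<chi> i. n * k' $ i)"
    by (simp add: vec_eq_iff grid_point_nth n)
  then show ?thesis
    using that by blast
qed

text \<open>Differences of grid coordinates are integer multiples of the mesh size, so an open
  condition on the distance of two nodes improves to a closed one with one step less.\<close>
lemma grid_gap:
  assumes "z \<in> range (grid_point S l)" "z' \<in> range (grid_point S l)"
    and "infnorm (z - z') < (of_int n + 1) * mesh_size l"
  shows "infnorm (z - z') \<le> of_int n * mesh_size l"
proof -
  obtain k k' where k: "z = grid_point S l k" "z' = grid_point S l k'"
    using assms by auto
  have "\<bar>(z - z') $ i\<bar> \<le> of_int n * mesh_size l" for i
  proof -
    have eq: "\<bar>(z - z') $ i\<bar> = of_int \<bar>k $ i - k' $ i\<bar> * mesh_size l"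
    proof -
      have "(z - z') $ i = of_int (k $ i - k' $ i) * mesh_size l"
        by (simp add: k grid_point_nth algebra_simps)
      then show ?thesis
        using mesh_size_pos[of l] by (simp add: abs_mult)
    qed
    have "\<bar>(z - z') $ i\<bar> < (of_int n + 1) * mesh_size l"
      using assms(3) infnorm_less_iff_cart by blast
    then have "real_of_int \<bar>k $ i - k' $ i\<bar> < of_int (n + 1)"
      unfolding eq using mesh_size_pos[of l] by (simp only: mult_less_cancel_right_pos of_int_add of_int_1)
    then have "\<bar>k $ i - k' $ i\<bar> \<le> n"
      by (simp only: of_int_less_iff)
    then have "real_of_int \<bar>k $ i - k' $ i\<bar> \<le> of_int n"
      by (simp only: of_int_le_iff)
    then show ?thesis
      unfolding eq using mesh_size_pos[of l] by (intro mult_right_mono) auto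
  qed
  then show ?thesis
    by (simp add: infnorm_le_iff_cart)
qed

lemma grid_point_eqI:
  assumes "z \<in> range (grid_point S l)" "z' \<in> range (grid_point S l)"
    and "infnorm (z - z') < mesh_size l"
  shows "z = z'"
proof -
  have "infnorm (z - z') \<le> 0"
    using grid_gap[OF assms(1,2), of 0] assms(3) by simp
  then have "infnorm (z - z') = 0"
    using infnorm_pos_le order_antisym by blast
  then show ?thesis
    by (simp add: infnorm_eq_0)
qed

lemma grid_cube_subsetI:
  assumes n: "mesh_size l' = of_int n * mesh_size l"
    and nest: "\<And>i. n * k' $ i \<le> k $ i \<and> k $ i + 1 \<le> n * (k' $ i + 1)"
  shows "grid_cube S l k \<subseteq> grid_cube S l' k'"
proof
  fix p
  assume p: "p \<in> grid_cube S l k"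
  have "orig S $ i + mesh_size l' * of_int (k' $ i) \<le> p $ i \<and>
        p $ i \<le> orig S $ i + mesh_size l' * of_int (k' $ i + 1)" for i
  proof -
    have "real_of_int (n * k' $ i) \<le> of_int (k $ i)"
      "real_of_int (k $ i + 1) \<le> of_int (n * (k' $ i + 1))"
      using nest[of i] by (simp_all only: of_int_le_iff)
    then have "mesh_size l * of_int (n * k' $ i) \<le> mesh_size l * of_int (k $ i)"
      "mesh_size l * of_int (k $ i + 1) \<le> mesh_size l * of_int (n * (k' $ i + 1))"
      using mesh_size_pos[of l] by (simp_all only: mult_le_cancel_left_pos)
    moreover have eq: "of_int n * mesh_size l * of_int a = mesh_size l * of_int (n * a)" for a
      by simp
    ultimately show ?thesis
      using p[unfolded mem_grid_cube, rule_format, of i] unfolding n eq by (intro conjI; linarith)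
  qed
  then show "p \<in> grid_cube S l' k'"
    by (simp add: mem_grid_cube)
qed

lemma fine_cube_subset_coarse_cube:
  assumes "l' \<le> l" "y \<in> interior (grid_cube S l k)" "y \<in> grid_cube S l' k'"
  shows "grid_cube S l k \<subseteq> grid_cube S l' k'"
proof -
  obtain n :: int where n: "mesh_size l' = of_int n * mesh_size l"
    using mesh_size_multiple assms(1) by metis
  have nest: "n * k' $ i \<le> k $ i \<and> k $ i + 1 \<le> n * (k' $ i + 1)" for i
  proof -
    have "mesh_size l * of_int (n * k' $ i) < mesh_size l * of_int (k $ i + 1)"
      using assms(2,3) unfolding mem_interior_grid_cube mem_grid_cube n
      by (auto simp: mult.assoc mult.left_commute dest!: spec[of _ i])
    then have 1: "n * k' $ i < k $ i + 1"
      using mesh_size_pos[of l] mult_less_cancel_left_pos of_int_less_iff by blast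
    have "mesh_size l * of_int (k $ i) < mesh_size l * of_int (n * (k' $ i + 1))"
      using assms(2,3) unfolding mem_interior_grid_cube mem_grid_cube n
      by (auto simp: mult.assoc mult.left_commute dest!: spec[of _ i])
    then have "k $ i < n * (k' $ i + 1)"
      using mesh_size_pos[of l] mult_less_cancel_left_pos of_int_less_iff by blast
    with 1 show ?thesis
      by auto
  qed
  then show ?thesis
    using grid_cube_subsetI n by blast
qed

lemma coarse_cube_covered:
  assumes "l' \<le> l" "y \<in> grid_cube S l' k'"
  obtains k where "y \<in> grid_cube S l k" "grid_cube S l k \<subseteq> grid_cube S l' k'"
proof -
  obtain n :: int where n: "0 < n" "mesh_size l' = of_int n * mesh_size l"
    using mesh_size_multiple assms(1) by metis
  have "\<exists>k. n * k' $ i \<le> k \<and> k + 1 \<le> n * (k' $ i + 1) \<and>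
            orig S $ i + mesh_size l * of_int k \<le> y $ i \<and>
            y $ i \<le> orig S $ i + mesh_size l * of_int (k + 1)" for i
  proof -
    define h where "h = mesh_size l"
    define t where "t = (y $ i - orig S $ i) / h"
    have h: "0 < h"
      by (simp add: h_def mesh_size_pos)
    have y: "y $ i = orig S $ i + h * t"
      using h by (simp add: t_def)
    have lo: "of_int (n * k' $ i) \<le> t" and up: "t \<le> of_int (n * (k' $ i + 1))"
    proof -
      have "h * of_int (n * k' $ i) \<le> h * t" "h * t \<le> h * of_int (n * (k' $ i + 1))"
        using assms(2)[unfolded mem_grid_cube, rule_format, of i]
        unfolding n(2) y h_def[symmetric] by (simp_all add: mult.assoc mult.left_commute)
      then show "of_int (n * k' $ i) \<le> t" "t \<le> of_int (n * (k' $ i + 1))"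
        using h mult_le_cancel_left_pos by blast+
    qed
    \<comment> \<open>The upper face of the coarse cube belongs to the last layer of fine cubes,
      where the floor would give an index one too large.\<close>
    define k where "k = min \<lfloor>t\<rfloor> (n * (k' $ i + 1) - 1)"
    have "n * k' $ i \<le> k"
      using lo n(1) unfolding k_def by (simp add: le_floor_iff distrib_left)
    moreover have "k + 1 \<le> n * (k' $ i + 1)"
      unfolding k_def by simp
    moreover have "of_int k \<le> t" "t \<le> of_int (k + 1)"
      using up unfolding k_def by linarith+
    ultimately show ?thesis
      unfolding y h_def[symmetric] using h by (intro exI[of _ k]) simp
  qed
  then obtain k where k: "\<And>i. n * k' $ i \<le> k i \<and> k i + 1 \<le> n * (k' $ i + 1) \<and>
            orig S $ i + mesh_size l * of_int (k i) \<le> y $ i \<and>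
            y $ i \<le> orig S $ i + mesh_size l * of_int (k i + 1)"
    by metis
  define K where "K = vec_lambda k"
  have "y \<in> grid_cube S l K"
    using k by (simp add: mem_grid_cube K_def)
  moreover have "grid_cube S l K \<subseteq> grid_cube S l' k'"
    using k by (intro grid_cube_subsetI[OF n(2)]) (simp add: K_def)
  ultimately show ?thesis
    using that by blast
qed

section \<open>Meshes of the domain\<close>

lemma mesh_covers_closure:
  assumes "valid_problem S" "lev_eps S \<le> l" "y \<in> closure (Dom S)"
  obtains k where "y \<in> grid_cube S l k" "grid_cube S l k \<in> mesh S l"
proof -
  obtain K where K: "K \<in> coarse S" "y \<in> K"
    using assms by (auto simp: valid_problem_def)
  then obtain k' where "K = grid_cube S (lev_eps S) k'"
    using assms(1) by (auto simp: valid_problem_def)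
  then obtain k where "y \<in> grid_cube S l k" "grid_cube S l k \<subseteq> K"
    using coarse_cube_covered[OF assms(2)] K by metis
  then show ?thesis
    using that[of k] K(1) by (auto simp: mesh_def)
qed

lemma mesh_subset_closure:
  assumes "valid_problem S" "Q \<in> mesh S l"
  shows "Q \<subseteq> closure (Dom S)"
  using assms by (fastforce simp: mesh_def valid_problem_def)

text \<open>Since \<open>D\<close> is open, it meets the interior of every cube that touches one of its points;
  an interior point of a fine cube lies in a mesh cube only if the whole fine cube does.\<close>
lemma cube_at_domain_point_in_mesh:
  assumes "valid_problem S" "lev_eps S \<le> l" "z \<in> Dom S" "z \<in> grid_cube S l k"
  shows "grid_cube S l k \<in> mesh S l"
proof -
  have "open (Dom S)"
    using assms(1) by (simp add: valid_problem_def)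
  moreover have "z \<in> Dom S \<inter> closure (interior (grid_cube S l k))"
    using assms closure_interior_grid_cube by auto
  ultimately obtain y where y: "y \<in> Dom S" "y \<in> interior (grid_cube S l k)"
    using open_Int_closure_eq_empty by blast
  then obtain K where K: "K \<in> coarse S" "y \<in> K"
    using assms(1) closure_subset unfolding valid_problem_def by blast
  then obtain k' where "K = grid_cube S (lev_eps S) k'"
    using assms(1) by (auto simp: valid_problem_def)
  then have "grid_cube S l k \<subseteq> K"
    using fine_cube_subset_coarse_cube[OF assms(2) y(2)] K by simp
  then show ?thesis
    using K(1) by (auto simp: mesh_def)
qed

lemma infnorm_ball_eq_box:
  fixes z :: "real^'n"
  shows "{y. infnorm (y - z) < r} = box (z - vec r) (z + vec r)"
proof -
  have "infnorm (y - z) < r \<longleftrightarrow> y \<in> box (z - vec r) (z + vec r)" for y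
    unfolding infnorm_less_iff_cart mem_box_cart by (simp add: abs_less_iff) (metis add.commute diff_less_eq less_diff_eq minus_diff_eq)
  then show ?thesis
    by blast
qed

lemma infnorm_cball_eq_cbox:
  fixes z :: "real^'n"
  shows "{y. infnorm (y - z) \<le> r} = cbox (z - vec r) (z + vec r)"
proof -
  have "infnorm (y - z) \<le> r \<longleftrightarrow> y \<in> cbox (z - vec r) (z + vec r)" for y
    unfolding infnorm_le_iff_cart mem_box_cart by (simp add: abs_le_iff) (metis add.commute diff_le_eq le_diff_eq minus_diff_eq)
  then show ?thesis
    by blast
qed

lemma interior_nodes_subset:
  "interior_nodes S l \<subseteq> nodes S l" "interior_nodes S l \<subseteq> range (grid_point S l)"
    "interior_nodes S l \<subseteq> Dom S"
  by (auto simp: interior_nodes_def nodes_def)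

text \<open>All \<open>2\<^sup>d\<close> grid cubes at an interior node belong to the mesh, so its patch is the full
  cube of radius \<open>h\<close> around it.\<close>
lemma interior_node_patch_in_domain:
  assumes "valid_problem S" "lev_eps S \<le> l" "z \<in> interior_nodes S l"
  shows "{y. infnorm (y - z) < mesh_size l} \<subseteq> Dom S"
proof -
  obtain k where k: "z = grid_point S l k"
    using assms(3) interior_nodes_subset by blast
  have "{y. infnorm (y - z) < mesh_size l} \<subseteq> \<Union> {Q \<in> mesh S l. z \<in> Q}"
  proof
    fix y
    assume y: "y \<in> {y. infnorm (y - z) < mesh_size l}"
    define k' where "k' = (\<chi> i. if y $ i < z $ i then k $ i - 1 else k $ i)"
    have "z \<in> grid_cube S l k'"
      using mesh_size_pos[of l] by (simp add: mem_grid_cube k k'_def grid_point_nth distrib_left right_diff_distrib)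
    moreover have "y \<in> grid_cube S l k'"
    proof -
      have "orig S $ i + mesh_size l * of_int (k' $ i) \<le> y $ i \<and>
            y $ i \<le> orig S $ i + mesh_size l * of_int (k' $ i + 1)" for i
      proof -
        have "\<bar>y $ i - z $ i\<bar> < mesh_size l"
          using y by (simp add: infnorm_less_iff_cart)
        then show ?thesis
          by (auto simp: k k'_def grid_point_nth distrib_left right_diff_distrib)
      qed
      then show ?thesis
        by (simp add: mem_grid_cube)
    qed
    ultimately show "y \<in> \<Union> {Q \<in> mesh S l. z \<in> Q}"
      using cube_at_domain_point_in_mesh[OF assms(1,2)] assms(3) interior_nodes_subset(3) by blast
  qed
  then have "{y. infnorm (y - z) < mesh_size l} \<subseteq> interior (\<Union> {Q \<in> mesh S l. z \<in> Q})"
    by (intro interior_maximal) (simp_all add: infnorm_ball_eq_box open_box)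
  then show ?thesis
    using assms(3) by (auto simp: interior_nodes_def)
qed

text \<open>This is where the second condition on interior nodes matters: in general a node in \<open>D\<close>
  may fail to be interior because of a slit, but inside the patch of an interior coarse node
  there is no slit.\<close>
lemma fine_node_in_coarse_patch_interior:
  assumes "valid_problem S" "lev_eps S < l" "z' \<in> interior_nodes S (l - 1)" "z \<in> nodes S l"
    and "infnorm (z - z') < mesh_size (l - 1)"
  shows "z \<in> interior_nodes S l"
proof -
  have patch: "{y. infnorm (y - z') < mesh_size (l - 1)} \<subseteq> Dom S"
    using interior_node_patch_in_domain[OF assms(1) _ assms(3)] assms(2) by simp
  obtain k' where "z' = grid_point S (l - 1) k'"
    using assms(3) interior_nodes_subset(2) by blast
  then have zr: "z \<in> range (grid_point S l)" "z' \<in> range (grid_point S l)"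
    using assms(4) grid_point_refine[of "l - 1" l S k'] by (auto simp: nodes_def)
  have zz': "infnorm (z - z') \<le> mesh_size l"
    using grid_gap[OF zr, of 1] assms(5) by (simp add: mesh_size_pred)
  have "\<Union> {Q \<in> mesh S l. z \<in> Q} \<subseteq> {y. infnorm (y - z) \<le> mesh_size l}"
  proof clarsimp
    fix Q y
    assume Q: "Q \<in> mesh S l" "z \<in> Q" "y \<in> Q"
    then obtain k where k: "Q = grid_cube S l k"
      by (auto simp: mesh_def)
    have "\<bar>(y - z) $ i\<bar> \<le> mesh_size l" for i
      using Q(2,3)[unfolded k mem_grid_cube, rule_format, of i] by (simp add: distrib_left abs_le_iff)
    then show "infnorm (y - z) \<le> mesh_size l"
      by (simp add: infnorm_le_iff_cart)
  qed
  from interior_mono[OF this]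
  have "interior (\<Union> {Q \<in> mesh S l. z \<in> Q}) \<subseteq> {y. infnorm (y - z) < mesh_size l}"
    unfolding infnorm_cball_eq_cbox infnorm_ball_eq_box by simp
  also have "\<dots> \<subseteq> {y. infnorm (y - z') < mesh_size (l - 1)}"
  proof clarsimp
    fix y
    assume "infnorm (y - z) < mesh_size l"
    then show "infnorm (y - z') < mesh_size (l - 1)"
      using infnorm_triangle[of "y - z" "z - z'"] zz' by (simp add: mesh_size_pred)
  qed
  finally have "interior (\<Union> {Q \<in> mesh S l. z \<in> Q}) \<subseteq> Dom S"
    using patch by blast
  then show ?thesis
    using assms(4,5) patch by (auto simp: interior_nodes_def)
qed

lemma finite_nodes:
  assumes "valid_problem S"
  shows "finite (nodes S l)"
proof -
  have "bounded (closure (Dom S))"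
    by (rule bounded_closure) (use assms in \<open>simp add: valid_problem_def\<close>)
  then obtain B where B: "\<And>y. y \<in> closure (Dom S) \<Longrightarrow> norm y \<le> B"
    unfolding bounded_iff by blast
  define N where "N = \<lceil>(B + norm (orig S)) / mesh_size l\<rceil>"
  have "nodes S l \<subseteq> grid_point S l ` vec_lambda ` (UNIV \<rightarrow>\<^sub>E {- N..N})"
  proof
    fix z
    assume z: "z \<in> nodes S l"
    then obtain k where k: "z = grid_point S l k"
      by (auto simp: nodes_def)
    have "z \<in> closure (Dom S)"
      using z mesh_subset_closure[OF assms] by (auto simp: nodes_def)
    then have zB: "norm z \<le> B"
      by (rule B)
    have "k $ i \<in> {- N..N}" for i
    proof -
      have "mesh_size l * \<bar>real_of_int (k $ i)\<bar> = \<bar>z $ i - orig S $ i\<bar>"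
        using mesh_size_pos[of l] by (simp add: k grid_point_nth abs_mult)
      also have "\<dots> \<le> B + norm (orig S)"
        using zB component_le_norm_cart[of z i] component_le_norm_cart[of "orig S" i] by linarith
      finally have "\<bar>of_int (k $ i)\<bar> \<le> (B + norm (orig S)) / mesh_size l"
        using mesh_size_pos[of l] by (simp add: le_divide_eq mult.commute)
      then have "\<bar>k $ i\<bar> \<le> N"
        unfolding N_def by linarith
      then show ?thesis
        by auto
    qed
    then have "k \<in> vec_lambda ` (UNIV \<rightarrow>\<^sub>E {- N..N})"
      by (intro image_eqI[of _ _ "vec_nth k"]) auto
    then show "z \<in> grid_point S l ` vec_lambda ` (UNIV \<rightarrow>\<^sub>E {- N..N})"
      using k by blast
  qed
  then show ?thesis
    by (rule finite_subset) (simp add: finite_PiE)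
qed

lemma finite_interior_nodes:
  assumes "valid_problem S"
  shows "finite (interior_nodes S l)"
  by (rule finite_subset[OF interior_nodes_subset(1) finite_nodes[OF assms]])

section \<open>Multilinear functions\<close>

lemma Q1_on_cmult:
  assumes "Q1_on Q v"
  shows "Q1_on Q (\<lambda>y. a * v y)"
proof -
  obtain c where c: "\<And>y. y \<in> Q \<Longrightarrow> v y = (\<Sum>I\<in>UNIV. c I * (\<Prod>i\<in>I. y $ i))"
    using assms unfolding Q1_on_def by blast
  then show ?thesis
    unfolding Q1_on_def by (intro exI[of _ "\<lambda>I. a * c I"]) (simp add: sum_distrib_left mult.assoc)
qed

lemma Q1_on_add:
  assumes "Q1_on Q v" "Q1_on Q w"
  shows "Q1_on Q (\<lambda>y. v y + w y)"
proof -
  obtain c where c: "\<And>y. y \<in> Q \<Longrightarrow> v y = (\<Sum>I\<in>UNIV. c I * (\<Prod>i\<in>I. y $ i))"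
    using assms unfolding Q1_on_def by blast
  obtain d where d: "\<And>y. y \<in> Q \<Longrightarrow> w y = (\<Sum>I\<in>UNIV. d I * (\<Prod>i\<in>I. y $ i))"
    using assms unfolding Q1_on_def by blast
  show ?thesis
    unfolding Q1_on_def
    by (intro exI[of _ "\<lambda>I. c I + d I"]) (simp add: c d sum.distrib distrib_right)
qed

lemma Q1_on_sum:
  assumes "\<And>a. a \<in> A \<Longrightarrow> Q1_on Q (f a)"
  shows "Q1_on Q (\<lambda>y. \<Sum>a\<in>A. f a y)"
  using assms
proof (induction A rule: infinite_finite_induct)
  case (insert a A)
  then show ?case
    by (simp add: Q1_on_add)
qed (auto simp: Q1_on_def intro!: exI[of _ "\<lambda>_. 0"])

lemma Q1_on_prod_affine:
  fixes f :: "'d::finite \<Rightarrow> real^'d \<Rightarrow> real"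
  assumes "\<And>i. \<exists>a b. \<forall>y\<in>Q. f i y = a * y $ i + b"
  shows "Q1_on Q (\<lambda>y. \<Prod>i\<in>UNIV. f i y)"
proof -
  obtain a b where ab: "\<And>i y. y \<in> Q \<Longrightarrow> f i y = a i * y $ i + b i"
    using assms by metis
  have "(\<Prod>i\<in>UNIV. f i y) = (\<Sum>I\<in>UNIV. ((\<Prod>i\<in>I. a i) * (\<Prod>i\<in>UNIV - I. b i)) * (\<Prod>i\<in>I. y $ i))"
    if "y \<in> Q" for y
    using that by (simp add: ab prod_add prod.distrib mult_ac)
  then show ?thesis
    unfolding Q1_on_def by (intro exI[of _ "\<lambda>I. (\<Prod>i\<in>I. a i) * (\<Prod>i\<in>UNIV - I. b i)"]) blast
qed

text \<open>With all coordinates but one fixed, the function is affine in the remaining one, so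
  vanishing at both ends of an edge means vanishing on its whole line.  Freeing the
  coordinates one after the other leads from the vertices to the whole space.\<close>
lemma multilinear_vanishes_if_zero_at_vertices:
  fixes c :: "'d::finite set \<Rightarrow> real" and a b :: "real^'d"
  defines "p \<equiv> \<lambda>y. \<Sum>I\<in>UNIV. c I * (\<Prod>i\<in>I. y $ i)"
  assumes ab: "\<And>i. a $ i \<noteq> b $ i"
    and vert: "\<And>y. (\<forall>i. y $ i \<in> {a $ i, b $ i}) \<Longrightarrow> p y = 0"
  shows "p y = 0"
proof -
  have "\<forall>y. (\<forall>i. i \<notin> J \<longrightarrow> y $ i \<in> {a $ i, b $ i}) \<longrightarrow> p y = 0" if "finite J" for J
    using that
  proof (induction J)
    case empty
    then show ?case
      using vert by simp
  next
    case (insert k J)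
    show ?case
    proof (intro allI impI)
      fix y
      assume y: "\<forall>i. i \<notin> insert k J \<longrightarrow> y $ i \<in> {a $ i, b $ i}"
      define Y where "Y = (\<lambda>t. \<chi> i. if i = k then t else y $ i)"
      define q where "q = (\<lambda>I. c I * (\<Prod>i\<in>I - {k}. y $ i))"
      define A where "A = (\<Sum>I\<in>UNIV. if k \<in> I then 0 else q I)"
      define B where "B = (\<Sum>I\<in>UNIV. if k \<in> I then q I else 0)"
      have "c I * (\<Prod>i\<in>I. Y t $ i) = (if k \<in> I then 0 else q I) + t * (if k \<in> I then q I else 0)"
        for t I
      proof (cases "k \<in> I")
        case True
        have "(\<Prod>i\<in>I. Y t $ i) = Y t $ k * (\<Prod>i\<in>I - {k}. Y t $ i)"
          using True by (simp add: prod.remove)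
        also have "(\<Prod>i\<in>I - {k}. Y t $ i) = (\<Prod>i\<in>I - {k}. y $ i)"
          by (intro prod.cong) (auto simp: Y_def)
        finally show ?thesis
          using True by (simp add: q_def Y_def)
      next
        case False
        then have "(\<Prod>i\<in>I. Y t $ i) = (\<Prod>i\<in>I - {k}. y $ i)"
          by (intro prod.cong) (auto simp: Y_def)
        then show ?thesis
          using False by (simp add: q_def)
      qed
      then have affine: "p (Y t) = A + t * B" for t
        unfolding p_def A_def B_def by (simp add: sum.distrib sum_distrib_left)
      have "p (Y t) = 0" if "t \<in> {a $ k, b $ k}" for t
      proof -
        have "\<forall>i. i \<notin> J \<longrightarrow> Y t $ i \<in> {a $ i, b $ i}"
          using y that by (auto simp: Y_def)
        then show ?thesis
          using insert.IH by blast
      qed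
      then have "A + a $ k * B = 0" "A + b $ k * B = 0"
        by (simp_all add: affine)
      then have "(a $ k - b $ k) * B = 0"
        unfolding left_diff_distrib by linarith
      then have "B = 0"
        using ab[of k] by simp
      then have "p (Y (y $ k)) = 0"
        using \<open>A + a $ k * B = 0\<close> by (simp add: affine)
      moreover have "Y (y $ k) = y"
        by (simp add: Y_def vec_eq_iff)
      ultimately show "p y = 0"
        by simp
    qed
  qed
  from this[of UNIV] show ?thesis
    by simp
qed

lemma Q1_on_grid_cube_determined_by_vertices:
  assumes v: "Q1_on (grid_cube S l k) v" and w: "Q1_on (grid_cube S l k) w"
    and eq: "\<And>z. z \<in> range (grid_point S l) \<inter> grid_cube S l k \<Longrightarrow> v z = w z"
    and y: "y \<in> grid_cube S l k"
  shows "v y = w y"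
proof -
  have "Q1_on (grid_cube S l k) (\<lambda>y. v y + (- 1) * w y)"
    using v w by (intro Q1_on_add Q1_on_cmult)
  then obtain c where c: "\<And>y. y \<in> grid_cube S l k \<Longrightarrow>
      v y + (- 1) * w y = (\<Sum>I\<in>UNIV. c I * (\<Prod>i\<in>I. y $ i))"
    unfolding Q1_on_def by blast
  have "(\<Sum>I\<in>UNIV. c I * (\<Prod>i\<in>I. y $ i)) = 0"
  proof (rule multilinear_vanishes_if_zero_at_vertices
      [where a = "grid_point S l k" and b = "grid_point S l (k + 1)"])
    show "grid_point S l k $ i \<noteq> grid_point S l (k + 1) $ i" for i
      using mesh_size_pos[of l] by (simp add: grid_point_nth)
  next
    fix z
    assume z: "\<forall>i. z $ i \<in> {grid_point S l k $ i, grid_point S l (k + 1) $ i}"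
    define k' where "k' = (\<chi> i. if z $ i = grid_point S l k $ i then k $ i else k $ i + 1)"
    have zk': "z = grid_point S l k'"
      unfolding vec_eq_iff
    proof
      fix i
      show "z $ i = grid_point S l k' $ i"
        using z[rule_format, of i] by (auto simp: k'_def grid_point_nth)
    qed
    have "z \<in> grid_cube S l k"
      unfolding zk' mem_grid_cube using mesh_size_pos[of l]
      by (simp add: k'_def grid_point_nth)
    then show "(\<Sum>I\<in>UNIV. c I * (\<Prod>i\<in>I. z $ i)) = 0"
      using eq[of z] zk' c[of z] by simp
  qed
  then show ?thesis
    using c[OF y] by simp
qed

text \<open>Every \<open>Q\<^sub>1\<close> function on a mesh cube is determined by its values at the vertices, and these
  are nodes.  This yields both the uniqueness of hat functions and the coarse-to-fine
  interpolation formula.\<close>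
lemma piecewise_Q1_determined_by_nodes:
  assumes "valid_problem S" "lev_eps S \<le> l"
    and v: "\<And>Q. Q \<in> mesh S l \<Longrightarrow> Q1_on Q v" and w: "\<And>Q. Q \<in> mesh S l \<Longrightarrow> Q1_on Q w"
    and out: "\<And>y. y \<notin> closure (Dom S) \<Longrightarrow> v y = w y"
    and eq: "\<And>z. z \<in> nodes S l \<Longrightarrow> v z = w z"
  shows "v = w"
proof
  fix y
  show "v y = w y"
  proof (cases "y \<in> closure (Dom S)")
    case True
    then obtain k where k: "y \<in> grid_cube S l k" "grid_cube S l k \<in> mesh S l"
      using mesh_covers_closure assms(1,2) by metis
    show ?thesis
    proof (rule Q1_on_grid_cube_determined_by_vertices[OF v[OF k(2)] w[OF k(2)] _ k(1)])
      fix z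
      assume "z \<in> range (grid_point S l) \<inter> grid_cube S l k"
      then show "v z = w z"
        using k(2) by (intro eq) (auto simp: nodes_def)
    qed
  qed (rule out)
qed

section \<open>Hat functions\<close>

text \<open>The hat function of an interior node in closed form, as a tensor product of
  one-dimensional hats.\<close>
definition tent :: "int \<Rightarrow> real^'d \<Rightarrow> real^'d \<Rightarrow> real" where
  "tent l z y = (\<Prod>i\<in>UNIV. max 0 (1 - \<bar>y $ i - z $ i\<bar> / mesh_size l))"

lemma tent_nonzero_iff: "tent l z y \<noteq> 0 \<longleftrightarrow> infnorm (y - z) < mesh_size l"
proof -
  have "max 0 (1 - \<bar>t\<bar> / mesh_size l) \<noteq> 0 \<longleftrightarrow> \<bar>t\<bar> < mesh_size l" for t :: real
    using mesh_size_pos[of l] by (auto simp: max_def divide_simps)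
  then show ?thesis
    by (simp add: tent_def infnorm_less_iff_cart)
qed

lemma tent_self: "tent l z z = 1"
  by (simp add: tent_def)

lemma tent_grid_point:
  assumes "z \<in> range (grid_point S l)" "z' \<in> range (grid_point S l)"
  shows "tent l z z' = (if z' = z then 1 else 0)"
  using grid_point_eqI[OF assms(2,1)] tent_nonzero_iff[of l z z'] by (auto simp: tent_self)

lemma continuous_on_tent: "continuous_on A (tent l z)"
  unfolding tent_def
  by (intro continuous_intros) (use mesh_size_pos[of l] in auto)

text \<open>The kinks of a one-dimensional hat of a coarse level lie on the coarse grid, hence on every
  finer one.\<close>
lemma Q1_on_tent:
  assumes "l' \<le> l" and z: "z = grid_point S l' k'"
  shows "Q1_on (grid_cube S l k) (tent l' z)"
  unfolding tent_def
proof (rule Q1_on_prod_affine)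
  fix i
  define h where "h = mesh_size l"
  obtain n :: int where n: "0 < n" "mesh_size l' = of_int n * h"
    using mesh_size_multiple[OF assms(1)] unfolding h_def by metis
  have h: "0 < h"
    by (simp add: h_def mesh_size_pos)
  define H where "H = mesh_size l'"
  have H: "0 < H"
    by (simp add: H_def mesh_size_pos)
  define m where "m = n * k' $ i"
  define x0 where "x0 = orig S $ i"
  have zi: "z $ i = x0 + h * of_int m"
    by (simp add: z grid_point_nth n m_def x0_def)
  have zH: "z $ i + H = x0 + h * of_int (m + n)" "z $ i - H = x0 + h * of_int (m - n)"
    by (simp_all add: zi H_def n algebra_simps)
  have y: "x0 + h * of_int (k $ i) \<le> y $ i \<and> y $ i \<le> x0 + h * of_int (k $ i + 1)"
    if "y \<in> grid_cube S l k" for y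
    using that unfolding mem_grid_cube h_def x0_def by blast
  have mono: "h * of_int p \<le> h * of_int q" if "p \<le> q" for p q :: int
    using that h by simp
  let ?f = "\<lambda>y::real^'a. max 0 (1 - \<bar>y $ i - z $ i\<bar> / H)"
  consider "k $ i + 1 \<le> m - n" | "m - n \<le> k $ i" "k $ i + 1 \<le> m"
    | "m \<le> k $ i" "k $ i + 1 \<le> m + n" | "m + n \<le> k $ i"
    by linarith
  then have "\<exists>a b. \<forall>y\<in>grid_cube S l k. ?f y = a * y $ i + b"
  proof cases
    case 1
    have "?f y = 0 * y $ i + 0" if "y \<in> grid_cube S l k" for y
    proof -
      have "y $ i \<le> z $ i - H"
        using y[OF that] mono[OF 1] unfolding zH by linarith
      then show ?thesis
        using H by (auto simp: max_def divide_simps)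
    qed
    then show ?thesis
      by blast
  next
    case 2
    have "?f y = (1 / H) * y $ i + (1 - z $ i / H)" if "y \<in> grid_cube S l k" for y
    proof -
      have "z $ i - H \<le> y $ i" "y $ i \<le> z $ i"
        using y[OF that] mono[OF 2(1)] mono[OF 2(2)] zH zi by linarith+
      then show ?thesis
        using H by (auto simp: max_def field_simps)
    qed
    then show ?thesis
      by blast
  next
    case 3
    have "?f y = (- 1 / H) * y $ i + (1 + z $ i / H)" if "y \<in> grid_cube S l k" for y
    proof -
      have "z $ i \<le> y $ i" "y $ i \<le> z $ i + H"
        using y[OF that] mono[OF 3(1)] mono[OF 3(2)] zH zi by linarith+
      then show ?thesis
        using H by (auto simp: max_def field_simps)
    qed
    then show ?thesis
      by blast
  next
    case 4
    have "?f y = 0 * y $ i + 0" if "y \<in> grid_cube S l k" for y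
    proof -
      have "z $ i + H \<le> y $ i"
        using y[OF that] mono[OF 4] unfolding zH by linarith
      then show ?thesis
        using H by (auto simp: max_def divide_simps)
    qed
    then show ?thesis
      by blast
  qed
  then show "\<exists>a b. \<forall>y\<in>grid_cube S l k. max 0 (1 - \<bar>y $ i - z $ i\<bar> / mesh_size l') = a * y $ i + b"
    unfolding H_def .
qed

lemma Q1_on_tent_mesh:
  assumes "l' \<le> l" "z \<in> range (grid_point S l')" "Q \<in> mesh S l"
  shows "Q1_on Q (tent l' z)"
  using assms by (auto simp: mesh_def intro: Q1_on_tent)

lemma hat_eq_tent:
  assumes "valid_problem S" "lev_eps S \<le> l" "z \<in> interior_nodes S l"
  shows "hat S l z = tent l z"
  unfolding hat_def
proof (rule the_equality)
  have zr: "z \<in> range (grid_point S l)"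
    using assms(3) interior_nodes_subset by blast
  have supp: "y \<in> Dom S" if "tent l z y \<noteq> 0" for y
    using interior_node_patch_in_domain[OF assms] that by (auto simp: tent_nonzero_iff)
  have "open (Dom S)"
    using assms(1) by (simp add: valid_problem_def)
  then have front: "tent l z y = 0" if "y \<in> frontier (Dom S)" for y
    using supp[of y] that by (auto simp: frontier_def interior_open)
  have out: "tent l z y = 0" if "y \<notin> closure (Dom S)" for y
    using supp[of y] that closure_subset by blast
  have kron: "tent l z z' = 0" if "z' \<in> nodes S l - {z}" for z'
    using tent_grid_point[OF zr, of z'] that by (auto simp: nodes_def)
  have Q1: "Q1_on Q (tent l z)" if "Q \<in> mesh S l" for Q
    using Q1_on_tent_mesh zr that by blast
  show "tent l z \<in> fe_space S l \<and> tent l z z = 1 \<and> (\<forall>z'\<in>nodes S l - {z}. tent l z z' = 0)"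
    using front out kron Q1 by (simp add: fe_space_def continuous_on_tent tent_self)
  show "v = tent l z"
    if v: "v \<in> fe_space S l \<and> v z = 1 \<and> (\<forall>z'\<in>nodes S l - {z}. v z' = 0)" for v
  proof (rule piecewise_Q1_determined_by_nodes[OF assms(1,2)])
    show "Q1_on Q v" if "Q \<in> mesh S l" for Q
      using v that by (simp add: fe_space_def)
    show "v y = tent l z y" if "y \<notin> closure (Dom S)" for y
      using v that out by (simp add: fe_space_def)
    show "v z' = tent l z z'" if "z' \<in> nodes S l" for z'
      using v that kron[of z'] by (cases "z' = z") (auto simp: tent_self)
  qed (rule Q1)
qed

lemma fe_fun_eq_sum_tent:
  assumes "valid_problem S" "lev_eps S \<le> l"
  shows "fe_fun S l x = (\<lambda>y. \<Sum>z\<in>interior_nodes S l. x z * tent l z y)"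
  by (simp add: fe_fun_def hat_eq_tent[OF assms])

lemma fe_fun_at_interior_node:
  assumes "valid_problem S" "lev_eps S \<le> l" "z \<in> interior_nodes S l"
  shows "fe_fun S l x z = x z"
proof -
  have "fe_fun S l x z = (\<Sum>z'\<in>interior_nodes S l. if z' = z then x z' else 0)"
    unfolding fe_fun_eq_sum_tent[OF assms(1,2)]
  proof (rule sum.cong)
    fix z'
    assume "z' \<in> interior_nodes S l"
    then have "tent l z' z = (if z = z' then 1 else 0)"
      using assms(3) interior_nodes_subset(2) by (intro tent_grid_point) auto
    then show "x z' * tent l z' z = (if z' = z then x z' else 0)"
      by auto
  qed simp
  then show ?thesis
    using assms(3) finite_interior_nodes[OF assms(1)] by simp
qed

text \<open>Nodal interpolation of a coarse hat function on the fine mesh reproduces it: it is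
  multilinear on each fine cube, and it vanishes at the fine nodes that carry no basis function.\<close>
lemma prolongation_eq_tent:
  assumes "valid_problem S" "lev_eps S < l"
    and z: "z \<in> interior_nodes S l" and z': "z' \<in> interior_nodes S (l - 1)"
  shows "prolongation S l z z' = tent (l - 1) z' z"
proof -
  have lev: "lev_eps S \<le> l" "lev_eps S \<le> l - 1"
    using assms(2) by auto
  define c where "c = (\<lambda>z. if z \<in> interior_nodes S l then tent (l - 1) z' z else 0)"
  have zero: "tent (l - 1) z' p = 0" if "p \<in> nodes S l - interior_nodes S l" for p
    using fine_node_in_coarse_patch_interior[OF assms(1,2) z', of p] that
    by (auto simp: tent_nonzero_iff[symmetric])
  have "fe_fun S l c = tent (l - 1) z'"
  proof (rule piecewise_Q1_determined_by_nodes[OF assms(1) lev(1)])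
    fix Q
    assume Q: "Q \<in> mesh S l"
    have "Q1_on Q (\<lambda>y. \<Sum>z\<in>interior_nodes S l. c z * tent l z y)"
      using Q interior_nodes_subset(2) by (intro Q1_on_sum Q1_on_cmult Q1_on_tent_mesh) auto
    then show "Q1_on Q (fe_fun S l c)"
      by (simp add: fe_fun_eq_sum_tent[OF assms(1) lev(1)])
    show "Q1_on Q (tent (l - 1) z')"
      using Q z' interior_nodes_subset(2) by (intro Q1_on_tent_mesh) auto
  next
    fix y
    assume y: "y \<notin> closure (Dom S)"
    have out: "tent l'' p y = 0" if "p \<in> interior_nodes S l''" "lev_eps S \<le> l''" for p l''
      using interior_node_patch_in_domain[OF assms(1) that(2,1)] y closure_subset[of "Dom S"]
      by (auto simp: tent_nonzero_iff[symmetric])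
    then show "fe_fun S l c y = tent (l - 1) z' y"
      using z' lev by (simp add: fe_fun_eq_sum_tent[OF assms(1) lev(1)])
  next
    fix p
    assume p: "p \<in> nodes S l"
    show "fe_fun S l c p = tent (l - 1) z' p"
    proof (cases "p \<in> interior_nodes S l")
      case True
      then show ?thesis
        by (simp add: fe_fun_at_interior_node[OF assms(1) lev(1)] c_def)
    next
      case False
      have "tent l q p = 0" if "q \<in> interior_nodes S l" for q
      proof -
        have "tent l q p = (if p = q then 1 else 0)"
          using that p interior_nodes_subset(2) by (intro tent_grid_point) (auto simp: nodes_def)
        then show ?thesis
          using that False by auto
      qed
      then show ?thesis
        using False p zero by (simp add: fe_fun_eq_sum_tent[OF assms(1) lev(1)])
    qed
  qed
  then have "coeffs S l (hat S (l - 1) z') = c"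
    unfolding coeffs_def hat_eq_tent[OF assms(1) lev(2) z']
  proof (intro the_equality)
    fix d
    assume d: "fe_fun S l d = tent (l - 1) z' \<and> (\<forall>z. z \<notin> interior_nodes S l \<longrightarrow> d z = 0)"
    show "d = c"
    proof
      fix p
      show "d p = c p"
        using d fe_fun_at_interior_node[OF assms(1) lev(1), of p d] by (auto simp: c_def)
    qed
  qed (simp add: c_def)
  then show ?thesis
    using z by (simp add: prolongation_def c_def)
qed

section \<open>Locality of the matrices\<close>

lemma grad_eq_0_if_locally_zero:
  fixes v :: "real^'d \<Rightarrow> real"
  assumes "open U" "y \<in> U" "\<And>p. p \<in> U \<Longrightarrow> v p = 0"
  shows "grad v y = 0"
proof -
  have "(v has_derivative (\<lambda>_. 0)) (at y)"
    by (rule has_derivative_transform_within_open[of "\<lambda>_. 0" _ y UNIV U])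
       (use assms in auto)
  then have "frechet_derivative v (at y) = (\<lambda>_. 0)"
    by (rule frechet_derivative_at[symmetric])
  then show ?thesis
    by (simp add: grad_def vec_eq_iff)
qed

text \<open>Nodes further apart than one step have a coordinate that differs by at least two steps.
  The classical gradient of a hat function need not exist on the faces of its patch, so two
  touching patches have disjoint interiors only up to the null set of such faces.\<close>
lemma stiffness_local:
  fixes S :: "('d::finite) mesh_problem"
  assumes "valid_problem S" "lev_eps S \<le> l"
    and "z \<in> interior_nodes S l" "z' \<in> interior_nodes S l" "stiffness S l z z' \<noteq> 0"
  shows "infnorm (z - z') \<le> mesh_size l"
proof (rule ccontr)
  define h where "h = mesh_size l"
  assume "\<not> infnorm (z - z') \<le> mesh_size l"
  then have "\<not> infnorm (z - z') < 2 * h"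
    using grid_gap[of z S l z' 1] assms(3,4) interior_nodes_subset(2) by (auto simp: h_def)
  then obtain i where i: "2 * h \<le> \<bar>z $ i - z' $ i\<bar>"
    by (auto simp: infnorm_less_iff_cart not_less)
  \<comment> \<open>\<open>F\<close> contains the two faces of the patch of \<open>z\<close> in direction \<open>i\<close>; off \<open>F\<close>, every point
    has a neighbourhood on which one of the two hats vanishes.\<close>
  define F where "F = {y. y $ i = z $ i + h} \<union> {y. y $ i = z $ i - h}"
  have tent_zero: "tent l q y = 0 \<and> grad (tent l q) y = 0" if "h < \<bar>y $ i - q $ i\<bar>" for q y :: "real^'d"
  proof -
    define U where "U = {y :: real^'d. h < \<bar>y $ i - q $ i\<bar>}"
    have zero: "tent l q p = 0" if "p \<in> U" for p
    proof -
      have "\<not> infnorm (p - q) < mesh_size l"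
        using that component_le_infnorm_cart[of "p - q" i] by (auto simp: U_def h_def)
      then show ?thesis
        using tent_nonzero_iff by blast
    qed
    have "open U"
      unfolding U_def by (intro open_Collect_less continuous_intros)
    then show ?thesis
      using zero grad_eq_0_if_locally_zero[of U y] that by (auto simp: U_def)
  qed
  have integrand_zero: "grad (tent l z') y \<bullet> grad (tent l z) y + pot S y * tent l z' y * tent l z y = 0"
    if "y \<notin> F" for y
  proof -
    have "h < \<bar>y $ i - z $ i\<bar> \<or> h < \<bar>y $ i - z' $ i\<bar>"
      using that i unfolding F_def by auto
    then show ?thesis
      using tent_zero by auto
  qed
  have "negligible {y :: real^'d. y $ i = t}" for t
    using negligible_standard_hyperplane[of "axis i 1 :: real^'d" t]
    by (simp add: axis_in_Basis_iff inner_axis)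
  then have "negligible F"
    unfolding F_def by (intro negligible_Un)
  then have "F \<in> null_sets lebesgue"
    by (simp add: negligible_iff_null_sets)
  then have "AE y in lebesgue. y \<notin> F"
    by (rule AE_not_in)
  then have "AE y in lebesgue. indicator (Dom S) y *\<^sub>R
      (grad (tent l z') y \<bullet> grad (tent l z) y + pot S y * tent l z' y * tent l z y) = 0"
    by (rule eventually_mono) (subst integrand_zero, auto)
  then have "stiffness S l z z' = 0"
    unfolding stiffness_def energy_def set_lebesgue_integral_def
      hat_eq_tent[OF assms(1,2,3)] hat_eq_tent[OF assms(1,2,4)]
    by (rule integral_eq_zero_AE)
  then show False
    using assms(5) by simp
qed

lemma prolongation_local:
  assumes "valid_problem S" "lev_eps S < l"
    and "z \<in> interior_nodes S l" "z' \<in> interior_nodes S (l - 1)" "prolongation S l z z' \<noteq> 0"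
  shows "infnorm (z - z') \<le> mesh_size l"
proof -
  have "tent (l - 1) z' z \<noteq> 0"
    using assms(5) prolongation_eq_tent[OF assms(1-4)] by simp
  then have "infnorm (z - z') < (of_int 1 + 1) * mesh_size l"
    by (simp add: tent_nonzero_iff mesh_size_pred)
  moreover obtain k where "z' = grid_point S (l - 1) k"
    using assms(4) interior_nodes_subset(2) by blast
  then have "z' \<in> range (grid_point S l)"
    using grid_point_refine[of "l - 1" l S k] by auto
  moreover have "z \<in> range (grid_point S l)"
    using assms(3) interior_nodes_subset(2) by blast
  ultimately show ?thesis
    using grid_gap[of z S l z' 1] by simp
qed

section \<open>Spreading of supports\<close>

text \<open>Only entries with index in \<open>I\<close> are constrained, because coefficient vectors take arbitrary
  values away from the interior nodes.  The set \<open>Z\<close> stands for the nodes carrying the right-hand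
  side; it is kept fixed while the radius grows, and the same \<open>Z\<close> serves on all levels.  A negative
  radius is allowed and forces \<open>b\<close> to vanish on \<open>I\<close>, as for the initial CG guess.\<close>
definition supported_near :: "(real^'d) set \<Rightarrow> (real^'d) set \<Rightarrow> real \<Rightarrow> (real^'d \<Rightarrow> real) \<Rightarrow> bool" where
  "supported_near I Z r b \<longleftrightarrow> (\<forall>z\<in>I. b z \<noteq> 0 \<longrightarrow> (\<exists>a\<in>Z. infnorm (z - a) \<le> r))"

lemma supported_near_mono:
  assumes "supported_near I Z r b" "r \<le> r'"
  shows "supported_near I Z r' b"
  using assms unfolding supported_near_def by (meson order_trans)

lemma supported_near_zero: "supported_near I Z r (\<lambda>_. 0)"
  by (simp add: supported_near_def)

lemma supported_near_cmult:
  assumes "supported_near I Z r b"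
  shows "supported_near I Z r (\<lambda>z. a * b z)"
  using assms by (simp add: supported_near_def)

lemma supported_near_add:
  assumes "supported_near I Z r b" "supported_near I Z r c"
  shows "supported_near I Z r (\<lambda>z. b z + c z)"
  unfolding supported_near_def
proof (intro ballI impI)
  fix z
  assume "z \<in> I" "b z + c z \<noteq> 0"
  then have "b z \<noteq> 0 \<or> c z \<noteq> 0"
    by auto
  then show "\<exists>a\<in>Z. infnorm (z - a) \<le> r"
    using assms \<open>z \<in> I\<close> unfolding supported_near_def by blast
qed

lemma supported_near_diff:
  assumes "supported_near I Z r b" "supported_near I Z r c"
  shows "supported_near I Z r (\<lambda>z. b z - c z)"
  using supported_near_add[OF assms(1) supported_near_cmult[OF assms(2), of "- 1"]] by simp

lemma supported_near_mat_vec: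
  assumes "supported_near J Z r b"
    and "\<And>i j. i \<in> I \<Longrightarrow> j \<in> J \<Longrightarrow> M i j \<noteq> 0 \<Longrightarrow> infnorm (i - j) \<le> s"
  shows "supported_near I Z (r + s) (mat_vec J M b)"
  unfolding supported_near_def
proof (intro ballI impI)
  fix i
  assume i: "i \<in> I" "mat_vec J M b i \<noteq> 0"
  then obtain j where j: "j \<in> J" "M i j * b j \<noteq> 0"
    unfolding mat_vec_def by (meson sum.not_neutral_contains_not_neutral)
  then obtain a where a: "a \<in> Z" "infnorm (j - a) \<le> r"
    using assms(1) unfolding supported_near_def by auto
  have "infnorm (i - a) \<le> infnorm (i - j) + infnorm (j - a)"
    using infnorm_triangle[of "i - j" "j - a"] by simp
  also have "\<dots> \<le> r + s"
    using assms(2)[OF i(1) j(1)] j(2) a(2) by simp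
  finally show "\<exists>a\<in>Z. infnorm (i - a) \<le> r + s"
    using a(1) by blast
qed

lemma supported_near_stiff_mult:
  assumes "valid_problem S" "lev_eps S \<le> l" "supported_near (interior_nodes S l) Z r b"
  shows "supported_near (interior_nodes S l) Z (r + mesh_size l) (stiff_mult S l b)"
  unfolding stiff_mult_def
  using stiffness_local[OF assms(1,2)] by (intro supported_near_mat_vec assms(3))

lemma supported_near_prolong:
  assumes "valid_problem S" "lev_eps S < l" "supported_near (interior_nodes S (l - 1)) Z r b"
  shows "supported_near (interior_nodes S l) Z (r + mesh_size l) (prolong S l b)"
  unfolding prolong_def
  using prolongation_local[OF assms(1,2)] by (intro supported_near_mat_vec assms(3))

lemma supported_near_restrict:
  assumes "valid_problem S" "lev_eps S < l" "supported_near (interior_nodes S l) Z r b"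
  shows "supported_near (interior_nodes S (l - 1)) Z (r + mesh_size l) (restrict S l b)"
  unfolding restrict_def
proof (intro supported_near_mat_vec assms(3))
  show "infnorm (z' - z) \<le> mesh_size l"
    if "z' \<in> interior_nodes S (l - 1)" "z \<in> interior_nodes S l" "prolongation S l z z' \<noteq> 0" for z z'
    using prolongation_local[OF assms(1,2) that(2,1,3)] by (simp add: infnorm_sub)
qed

lemma supported_near_jacobi:
  assumes "supported_near I Z r b"
  shows "supported_near I Z r (jacobi S l b)"
  using assms by (auto simp: supported_near_def jacobi_def)

text \<open>On each level above the coarsest, one restriction, one prolongation and one residual
  evaluation each widen the support by \<open>h\<^sub>l\<close>, wherever the smoothing step is placed.
  The sum of \<open>3 h\<^sub>l\<close> over these levels telescopes, since \<open>h\<^sub>l = h\<^sub>l\<^sub>-\<^sub>1 - h\<^sub>l\<close>.\<close>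
lemma supported_near_vcycle:
  assumes S: "valid_problem S" and "lev_eps S \<le> l" "supported_near (interior_nodes S l) Z r b"
  shows "supported_near (interior_nodes S l) Z (r + 3 * (mesh_size (lev_eps S) - mesh_size l))
           (vcycle S m l b)"
  using assms(2,3)
proof (induction l arbitrary: r b rule: int_ge_induct)
  case base
  then show ?case
    by (subst vcycle.simps) (simp add: supported_near_jacobi)
next
  case (step l')
  define l where "l = l' + 1"
  define h where "h = mesh_size l"
  define e where "e = mesh_size (lev_eps S)"
  have lev: "lev_eps S \<le> l" "lev_eps S < l" and l': "l - 1 = l'"
    using step.hyps by (auto simp: l_def)
  have h: "0 < h" and h': "mesh_size (l - 1) = 2 * h" and he: "2 * h \<le> e"
    using mesh_size_pos mesh_size_pred[of l] mesh_size_antimono[of "lev_eps S" "l - 1"] lev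
    by (auto simp: h_def e_def)
  note b = step.prems[folded l_def]
  note A = supported_near_stiff_mult[OF S lev(1), folded h_def]
    and P = supported_near_prolong[OF S lev(2), folded h_def]
    and R = supported_near_restrict[OF S lev(2), folded h_def]
    and IH = step.IH[folded l' e_def, unfolded h']
  show ?case
    unfolding l_def[symmetric] h_def[symmetric] e_def[symmetric]
  proof (cases m)
    case Pre_Smoothing
    define y where "y = jacobi S l b"
    define c where "c = prolong S l (vcycle S m (l - 1) (restrict S l (\<lambda>z. b z - stiff_mult S l y z)))"
    have y: "supported_near (interior_nodes S l) Z r y"
      unfolding y_def by (intro supported_near_jacobi b)
    have "supported_near (interior_nodes S l) Z (r + h) (\<lambda>z. b z - stiff_mult S l y z)"
      by (intro supported_near_diff A y supported_near_mono[OF b]) (use h in simp)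
    from P[OF IH[OF R[OF this]]]
    have "supported_near (interior_nodes S l) Z (r + 3 * (e - h)) c"
      unfolding c_def by (rule supported_near_mono) simp
    moreover have "supported_near (interior_nodes S l) Z (r + 3 * (e - h)) y"
      using y by (rule supported_near_mono) (use h he in simp)
    moreover have "vcycle S m l b = (\<lambda>z. y z + c z)"
      using lev Pre_Smoothing by (subst vcycle.simps) (simp add: Let_def y_def c_def)
    ultimately show "supported_near (interior_nodes S l) Z (r + 3 * (e - h)) (vcycle S m l b)"
      by (simp add: supported_near_add)
  next
    case Post_Smoothing
    define y where "y = prolong S l (vcycle S m (l - 1) (restrict S l b))"
    define c where "c = jacobi S l (\<lambda>z. b z - stiff_mult S l y z)"
    from P[OF IH[OF R[OF b]]]
    have y: "supported_near (interior_nodes S l) Z (r + 3 * (e - h) - h) y"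
      unfolding y_def by (rule supported_near_mono) simp
    have "supported_near (interior_nodes S l) Z (r + 3 * (e - h)) (stiff_mult S l y)"
      using A[OF y] by (simp only: diff_add_cancel)
    moreover have "supported_near (interior_nodes S l) Z (r + 3 * (e - h)) b"
      using b by (rule supported_near_mono) (use h he in simp)
    ultimately have "supported_near (interior_nodes S l) Z (r + 3 * (e - h)) c"
      unfolding c_def by (intro supported_near_jacobi supported_near_diff)
    moreover have "supported_near (interior_nodes S l) Z (r + 3 * (e - h)) y"
      using y by (rule supported_near_mono) (use h in simp)
    moreover have "vcycle S m l b = (\<lambda>z. y z + c z)"
      using lev Post_Smoothing by (subst vcycle.simps) (simp add: Let_def y_def c_def)
    ultimately show "supported_near (interior_nodes S l) Z (r + 3 * (e - h)) (vcycle S m l b)"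
      by (simp add: supported_near_add)
  qed
qed

text \<open>For linear \<open>B\<close>, the iterate \<open>x\<^sub>j\<close> is a combination of \<open>(B A)\<^sup>i B b\<close> with \<open>i < j\<close>: it involves \<open>j\<close>
  applications of \<open>B\<close> but only \<open>j - 1\<close> of \<open>A\<close>.  The missing application leaves room for the
  width of the hat functions.  The induction follows the recursion itself, in which a step first
  extends \<open>x\<close> by the old direction and then applies \<open>A\<close> and \<open>B\<close> once each.\<close>
lemma supported_near_pcg:
  assumes A: "\<And>r v. supported_near I Z r v \<Longrightarrow> supported_near I Z (r + h) (mat_vec I A v)"
    and B: "\<And>r v. supported_near I Z r v \<Longrightarrow> supported_near I Z (r + d) (B v)"
    and "0 \<le> h" "0 \<le> d" and b: "supported_near I Z 0 b"
  shows "supported_near I Z (real j * (d + h) - h) (pcg I A B j b)"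
proof -
  define ok where "ok = (\<lambda>R (x, r, s, p). supported_near I Z (R - h) x \<and> supported_near I Z R r \<and>
    supported_near I Z (R + d) s \<and> supported_near I Z (R + d) p)"
  \<comment> \<open>A stopped iteration keeps its state, which satisfies the weaker bound of the next step.\<close>
  have ok_mono: "ok R' st" if "ok R st" "R \<le> R'" for R R' st
    using that unfolding ok_def by (auto elim!: supported_near_mono split: prod.splits)
  have ok_step: "ok (R + d + h) (pcg_step I A B st)" if st: "ok R st" for R st
  proof -
    obtain x r s p where st_eq: "st = (x, r, s, p)"
      by (cases st) auto
    have x: "supported_near I Z (R - h) x" and r: "supported_near I Z R r"
      and p: "supported_near I Z (R + d) p"
      using st by (auto simp: ok_def st_eq)
    define Ap where "Ap = mat_vec I A p"
    define \<alpha> where "\<alpha> = dot I r s / dot I p Ap"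
    define x' where "x' = (\<lambda>i. x i + \<alpha> * p i)"
    define r' where "r' = (\<lambda>i. r i - \<alpha> * Ap i)"
    define s' where "s' = B r'"
    define p' where "p' = (\<lambda>i. s' i + (dot I r' s' / dot I r s) * p i)"
    have "supported_near I Z (R + d) x'"
      unfolding x'_def
      by (intro supported_near_add supported_near_cmult p supported_near_mono[OF x])
         (use assms(3,4) in simp)
    moreover have "supported_near I Z (R + d + h) r'"
      unfolding r'_def Ap_def
      by (intro supported_near_diff supported_near_cmult A p supported_near_mono[OF r])
         (use assms(3,4) in simp)
    moreover from this have "supported_near I Z (R + d + h + d) s'"
      unfolding s'_def by (rule B)
    moreover from this have "supported_near I Z (R + d + h + d) p'"
      unfolding p'_def
      by (intro supported_near_add supported_near_cmult supported_near_mono[OF p])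
         (use assms(3,4) in simp_all)
    ultimately have "ok (R + d + h) (x', r', s', p')"
      by (simp add: ok_def)
    moreover have "ok (R + d + h) st"
      using st by (rule ok_mono) (use assms(3,4) in simp)
    moreover have "pcg_step I A B st = (if dot I p Ap = 0 \<or> dot I r s = 0 then st else (x', r', s', p'))"
      by (simp add: pcg_step_def st_eq Let_def Ap_def \<alpha>_def x'_def r'_def s'_def p'_def)
    ultimately show ?thesis
      by simp
  qed
  have "ok (real j * (d + h)) ((pcg_step I A B ^^ j) ((\<lambda>_. 0), b, B b, B b))"
  proof (induction j)
    case 0
    show ?case
      using b B[OF b] by (simp add: ok_def supported_near_zero)
  next
    case (Suc j)
    from ok_step[OF this] show ?case
      by (simp add: algebra_simps)
  qed
  then show ?thesis
    by (auto simp: ok_def pcg_def split: prod.splits)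
qed

lemma supported_near_mg_pcg:
  assumes "valid_problem S" "supported_near (interior_nodes S (lev_h S)) Z 0 b"
  shows "supported_near (interior_nodes S (lev_h S)) Z
           (3 * real j * mesh_size (lev_eps S) - mesh_size (lev_h S)) (mg_pcg S m j b)"
proof -
  define h where "h = mesh_size (lev_h S)"
  define e where "e = mesh_size (lev_eps S)"
  have lev: "lev_eps S \<le> lev_h S"
    using assms(1) by (simp add: valid_problem_def)
  have h: "0 < h" "h \<le> e"
    using mesh_size_pos mesh_size_antimono[OF lev] by (auto simp: h_def e_def)
  have "supported_near (interior_nodes S (lev_h S)) Z (real j * (3 * (e - h) + h) - h) (mg_pcg S m j b)"
    unfolding mg_pcg_def
  proof (rule supported_near_pcg)
    show "supported_near (interior_nodes S (lev_h S)) Z (r + h)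
        (mat_vec (interior_nodes S (lev_h S)) (stiffness S (lev_h S)) v)"
      if "supported_near (interior_nodes S (lev_h S)) Z r v" for r v
      using supported_near_stiff_mult[OF assms(1) lev that] by (simp add: stiff_mult_def h_def)
    show "supported_near (interior_nodes S (lev_h S)) Z (r + 3 * (e - h)) (vcycle S m (lev_h S) v)"
      if "supported_near (interior_nodes S (lev_h S)) Z r v" for r v
      using supported_near_vcycle[OF assms(1) lev that] by (simp add: h_def e_def)
  qed (use h assms(2) in auto)
  \<comment> \<open>\<open>3 (e - h) + h = 3 e - 2 h\<close>, so \<open>2 h\<close> per step are given away here.\<close>
  moreover have "real j * (3 * (e - h) + h) - h \<le> 3 * real j * e - h"
    using h by (simp add: algebra_simps)
  ultimately show ?thesis
    unfolding h_def e_def by (rule supported_near_mono)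
qed

lemma dist_inf_le:
  assumes "a \<in> A"
  shows "dist_inf y A \<le> infnorm (y - a)"
  unfolding dist_inf_def
  by (rule cINF_lower[OF _ assms]) (auto intro!: bdd_belowI[of _ 0] infnorm_pos_le)

section \<open>Supports of the multigrid-preconditioned CG iterates\<close>

theorem theorem3p1:
  fixes S :: "('d::finite) mesh_problem" and m :: smoothing and j :: nat
    and x :: "real^'d \<Rightarrow> real" and u w :: "real^'d \<Rightarrow> real"
  assumes "valid_problem S"
    and "j \<ge> 1"
    and "u = fe_fun S (lev_h S) x"
    and "w = fe_fun S (lev_h S) (mg_pcg S m j x)"
  shows "supp w \<subseteq> {y \<in> closure (Dom S). dist_inf y (supp u) \<le> 3 * real j * mesh_size (lev_eps S)}
         \<and> (u = (\<lambda>y. 0) \<longrightarrow> w = (\<lambda>y. 0))"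
proof -
  define R where "R = 3 * real j * mesh_size (lev_eps S)"
  define l where "l = lev_h S"
  define N where "N = interior_nodes S l"
  define Z where "Z = {z \<in> N. x z \<noteq> 0}"
  have lev: "lev_eps S \<le> l"
    using assms(1) by (simp add: valid_problem_def l_def)
  have "finite Z"
    using finite_interior_nodes[OF assms(1)] by (simp add: Z_def N_def)
  have u_Z: "u a \<noteq> 0" if "a \<in> Z" for a
    using that fe_fun_at_interior_node[OF assms(1) lev] by (simp add: assms(3) Z_def N_def l_def)
  have "supported_near N Z 0 x"
    by (auto simp: supported_near_def Z_def infnorm_0 intro!: bexI)
  then have near: "supported_near N Z (R - mesh_size l) (mg_pcg S m j x)"
    using supported_near_mg_pcg[OF assms(1)] by (simp add: N_def l_def R_def)
  \<comment> \<open>The radius \<open>R - h\<close> of the coefficients leaves exactly the width \<open>h\<close> of a hat.\<close>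
  have w_near: "y \<in> closure (Dom S) \<and> (\<exists>a\<in>Z. infnorm (y - a) \<le> R)" if "w y \<noteq> 0" for y
  proof -
    have "(\<Sum>z\<in>N. mg_pcg S m j x z * tent l z y) \<noteq> 0"
      using that by (simp add: assms(4) N_def l_def[symmetric] fe_fun_eq_sum_tent[OF assms(1) lev])
    then obtain z where z: "z \<in> N" "mg_pcg S m j x z * tent l z y \<noteq> 0"
      by (meson sum.not_neutral_contains_not_neutral)
    then have yz: "infnorm (y - z) < mesh_size l"
      by (simp add: tent_nonzero_iff)
    then have "y \<in> closure (Dom S)"
      using interior_node_patch_in_domain[OF assms(1) lev, of z] z(1) closure_subset
      by (auto simp: N_def)
    moreover obtain a where "a \<in> Z" "infnorm (z - a) \<le> R - mesh_size l"
      using near z unfolding supported_near_def by auto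
    moreover have "infnorm (y - a) \<le> infnorm (y - z) + infnorm (z - a)"
      using infnorm_triangle[of "y - z" "z - a"] by simp
    ultimately show ?thesis
      using yz by (intro conjI bexI[of _ a]) auto
  qed
  \<comment> \<open>The support is a closure, so a closed set containing the nonzero points is needed; the union
    over \<open>Z\<close> is closed because \<open>Z\<close> is finite.\<close>
  define C where "C = closure (Dom S) \<inter> (\<Union>a\<in>Z. {y. infnorm (y - a) \<le> R})"
  have "closed C"
    using \<open>finite Z\<close> by (auto simp: C_def infnorm_cball_eq_cbox intro!: closed_Int closed_UN)
  moreover have "{y. w y \<noteq> 0} \<subseteq> C"
    using w_near by (auto simp: C_def)
  ultimately have "supp w \<subseteq> C"
    unfolding supp_def by (rule closure_minimal[rotated])
  moreover have "dist_inf y (supp u) \<le> R" if "a \<in> Z" "infnorm (y - a) \<le> R" for y a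
  proof -
    have "a \<in> supp u"
      using u_Z[OF that(1)] closure_subset[of "{y. u y \<noteq> 0}"] unfolding supp_def by blast
    then show ?thesis
      using dist_inf_le that(2) order_trans by blast
  qed
  ultimately have "supp w \<subseteq> {y \<in> closure (Dom S). dist_inf y (supp u) \<le> R}"
    unfolding C_def by blast
  moreover have "w = (\<lambda>y. 0)" if "u = (\<lambda>y. 0)"
    using that u_Z w_near by fastforce
  ultimately show ?thesis
    by (simp add: R_def)
qed

end
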